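(* Let $n\ge1$, let $I=[0,1]$, let $\mathcal{S}$ be a scale-invariant sigmoidal activation, and let $\mathcal{M}$ be the set of all activated MPS functions on $I^n$ with activation $\mathcal{S}$. Then $\mathcal{M}$ is dense in $C^0(I^n)$ (the real continuous functions on $I^n$) with respect to the supremum norm: for every $f\in C^0(I^n)$ and every $\epsilon>0$ there exists $\Psi\in\mathcal{M}$ such that $\sup_{\mathbf{x}\in I^n}|\Psi(\mathbf{x})-f(\mathbf{x})|<\epsilon$.
   Context: Scale-invariant sigmoidal activation: a family $\mathcal{S}$ of continuous functions $\sigma:\mathbb{R}\to\mathbb{R}$ such that (i) every $\sigma\in\mathcal{S}$ satisfies $\sigma(x)\to0$ as $x\to-\infty$ and $\sigma(x)\to C$ as $x\to+\infty$ for some real $C$ depending on $\sigma$; (ii) $C\neq0$ for at least one $\sigma\in\mathcal{S}$; (iii) $k\sigma\in\mathcal{S}$ for all $\sigma\in\mathcal{S}$ and $k\in\mathbb{R}$. (The limit $C$ is a tunable parameter of the activation, which may be chosen separately for each term of the sum below.) Activated MPS function on $I^n$ with activation $\mathcal{S}$: a function of the form $$\Psi(\mathbf{x})=\sum_{l=1}^{D}\sigma_l\Big(\sum_{\{\alpha,s\}}A^{s_1}_{(1)\,\alpha_1\alpha_2}\cdots A^{l s_i}_{(i)\,\alpha_i\alpha_{i+1}}\cdots A^{s_n}_{(n)\,\alpha_n\alpha_1}\,\Phi^{s_1\cdots s_n}(\mathbf{x})\Big),\qquad \Phi^{s_1\cdots s_n}(\mathbf{x})=\prod_{j=1}^n\phi_j^{s_j}(x_j),$$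 where $D\ge1$ is an integer; $\sigma_1,\dots,\sigma_D\in\mathcal{S}$; $i\in\{1,\dots,n\}$ is the one site carrying the extra index $l$; for each $j$, $s_j$ ranges over $\{1,\dots,d_j\}$ and $\alpha_j$ over $\{1,\dots,D_j\}$ for integers $d_j,D_j\ge1$ (with $\alpha_{n+1}=\alpha_1$, $D_{n+1}=D_1$); for $j\ne i$, $A_{(j)}$ is a real tensor of size $d_j\times D_j\times D_{j+1}$, and $A_{(i)}$ is a real tensor of size $D\times d_i\times D_i\times D_{i+1}$; and each $\phi_j:I\to\mathbb{R}^{d_j}$ is continuous. The inner sum is over all $\alpha_j,s_j$. All of $D$, $i$, $d_j$, $D_j$, the tensors, the kernel maps $\phi_j$ and the $\sigma_l\in\mathcal{S}$ are free to be chosen. *)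

theory Defs
  imports "HOL-Analysis.Analysis"
begin

(* Points of I^n are extensional functions on {1..n}; the product topology on nat => real
   restricts to the usual topology of I^n on this set. *)
definition hypercube :: "nat \<Rightarrow> (nat \<Rightarrow> real) set" where
  "hypercube n = {1..n} \<rightarrow>\<^sub>E {0..1}"

definition scale_invariant_sigmoidal :: "(real \<Rightarrow> real) set \<Rightarrow> bool" where
  "scale_invariant_sigmoidal S \<longleftrightarrow>
     (\<forall>\<sigma>\<in>S. continuous_on UNIV \<sigma> \<and> (\<sigma> \<longlongrightarrow> 0) at_bot \<and> (\<exists>C. (\<sigma> \<longlongrightarrow> C) at_top)) \<and>
     (\<exists>\<sigma>\<in>S. \<exists>C. C \<noteq> 0 \<and> (\<sigma> \<longlongrightarrow> C) at_top) \<and>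
     (\<forall>\<sigma>\<in>S. \<forall>k. (\<lambda>x. k * \<sigma> x) \<in> S)"

definition cyc_next :: "nat \<Rightarrow> nat \<Rightarrow> nat" where
  "cyc_next n j = (if j = n then 1 else j + 1)"

definition product_kernel ::
  "nat \<Rightarrow> (nat \<Rightarrow> real \<Rightarrow> nat \<Rightarrow> real) \<Rightarrow> (nat \<Rightarrow> nat) \<Rightarrow> (nat \<Rightarrow> real) \<Rightarrow> real" where
  "product_kernel n \<phi> s x = (\<Prod>j=1..n. \<phi> j (x j) (s j))"

(* Periodic contraction of site tensors T j s a b, with physical dimensions d j and
   bond dimensions bd j. *)
definition mps_contraction ::
  "nat \<Rightarrow> (nat \<Rightarrow> nat) \<Rightarrow> (nat \<Rightarrow> nat) \<Rightarrow> (nat \<Rightarrow> nat \<Rightarrow> nat \<Rightarrow> nat \<Rightarrow> real) \<Rightarrow>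
   (nat \<Rightarrow> real \<Rightarrow> nat \<Rightarrow> real) \<Rightarrow> (nat \<Rightarrow> real) \<Rightarrow> real" where
  "mps_contraction n d bd T \<phi> x =
     (\<Sum>\<alpha> \<in> (\<Pi>\<^sub>E j\<in>{1..n}. {1..bd j}). \<Sum>s \<in> (\<Pi>\<^sub>E j\<in>{1..n}. {1..d j}).
        (\<Prod>j=1..n. T j (s j) (\<alpha> j) (\<alpha> (cyc_next n j))) * product_kernel n \<phi> s x)"

(* m is the number of terms (the range of the extra index l), B is the tensor of the site i that
   carries this index, and A j is the tensor of every other site j. Tensors are total functions
   whose values outside the index ranges are never used (nor is A i), and only the values of a
   member on the hypercube are constrained. *)
definition activated_mps :: "nat \<Rightarrow> (real \<Rightarrow> real) set \<Rightarrow> ((nat \<Rightarrow> real) \<Rightarrow> real) set" where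
  "activated_mps n S =
     {\<Psi>. \<exists>(m::nat) (\<sigma> :: nat \<Rightarrow> real \<Rightarrow> real) (i::nat) (d :: nat \<Rightarrow> nat) (bd :: nat \<Rightarrow> nat)
            (A :: nat \<Rightarrow> nat \<Rightarrow> nat \<Rightarrow> nat \<Rightarrow> real) (B :: nat \<Rightarrow> nat \<Rightarrow> nat \<Rightarrow> nat \<Rightarrow> real)
            (\<phi> :: nat \<Rightarrow> real \<Rightarrow> nat \<Rightarrow> real).
          m \<ge> 1 \<and> (\<forall>l\<in>{1..m}. \<sigma> l \<in> S) \<and> i \<in> {1..n} \<and>
          (\<forall>j\<in>{1..n}. d j \<ge> 1 \<and> bd j \<ge> 1) \<and>
          (\<forall>j\<in>{1..n}. \<forall>s\<in>{1..d j}. continuous_on {0..1} (\<lambda>t. \<phi> j t s)) \<and>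
          (\<forall>x\<in>hypercube n. \<Psi> x = (\<Sum>l=1..m. \<sigma> l (mps_contraction n d bd (A(i := B l)) \<phi> x)))}"

lemma activated_mps_continuous:
  assumes "scale_invariant_sigmoidal S" and "\<Psi> \<in> activated_mps n S"
  shows "continuous_on (hypercube n) \<Psi>"
proof -
  obtain m \<sigma> i d bd A B \<phi> where
    \<sigma>: "\<forall>l\<in>{1..m}. \<sigma> l \<in> S" and
    \<phi>: "\<forall>j\<in>{1..n}. \<forall>s\<in>{1..d j}. continuous_on {0..1} (\<lambda>t. \<phi> j t s)" and
    eq: "\<forall>x\<in>hypercube n. \<Psi> x =
           (\<Sum>l=(1::nat)..m. \<sigma> l (mps_contraction n d bd (A(i := B l)) \<phi> x))"
    using assms(2) unfolding activated_mps_def by blast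
  have coord: "continuous_on (hypercube n) (\<lambda>x. x j)" for j
    by (rule continuous_on_subset[OF continuous_on_product_coordinates]) simp
  have \<phi>': "continuous_on (hypercube n) (\<lambda>x. \<phi> j (x j) (s j))"
    if "j \<in> {1..n}" "s \<in> (\<Pi>\<^sub>E j\<in>{1..n}. {1..d j})" for j s
  proof -
    have "s j \<in> {1..d j}" using that by (auto simp: PiE_iff)
    then have "continuous_on {0..1} (\<lambda>t. \<phi> j t (s j))" using \<phi> that(1) by blast
    moreover have "(\<lambda>x. x j) ` hypercube n \<subseteq> {0..1}"
      using that(1) unfolding hypercube_def by (auto simp: PiE_iff)
    ultimately show ?thesis using continuous_on_compose2[OF _ coord] by blast
  qed
  have mps: "continuous_on (hypercube n) (\<lambda>x. mps_contraction n d bd T \<phi> x)" for T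
    unfolding mps_contraction_def product_kernel_def
    by (intro continuous_intros \<phi>')
  have \<sigma>_cont: "continuous_on UNIV (\<sigma> l)" if "l \<in> {1..m}" for l
    using \<sigma> that assms(1) unfolding scale_invariant_sigmoidal_def by blast
  have "continuous_on (hypercube n)
          (\<lambda>x. \<Sum>l=1..m. \<sigma> l (mps_contraction n d bd (A(i := B l)) \<phi> x))"
    by (intro continuous_on_sum continuous_on_compose2[OF \<sigma>_cont mps]) auto
  then show ?thesis using eq by (simp cong: continuous_on_cong)
qed

end

theory Submission
  imports Defs
begin

text \<open>Diagonal site tensors turn the contraction into an arbitrary finite linear combination of
  products of univariate continuous functions, with a free choice of coefficients for each term
  \<open>l\<close>; by Stone--Weierstrass these are dense in the continuous functions, so by uniform continuity
  it suffices to approximate \<open>f\<close> by sums of \<open>w * \<sigma> (h x)\<close> with \<open>h\<close> continuous. Any non-constant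
  continuous \<open>\<sigma>\<close> does this: on a compact interval it attains its minimum and maximum, so
  interpolating between a minimizer and a maximizer according to the value of \<open>f\<close> gives a function
  of this kind that lies within two thirds of the sup norm of \<open>f\<close>, as in the proof of the Tietze
  extension theorem, and this step can be iterated on the error.\<close>

section \<open>Weighted superpositions of one activation\<close>

text \<open>The class \<open>H\<close> of inner functions is a parameter because two instances are
  compared: all continuous functions, where approximation is easy, and the separable ones, which an
  MPS contraction can produce. Sums are nonempty by construction, matching the requirement of at
  least one activated term.\<close>

inductive_set superpositions :: "(real \<Rightarrow> real) \<Rightarrow> ('a \<Rightarrow> real) set \<Rightarrow> ('a \<Rightarrow> real) set"
  for \<sigma> :: "real \<Rightarrow> real" and H :: "('a \<Rightarrow> real) set"
  where
    unit: "h \<in> H \<Longrightarrow> (\<lambda>x. w * \<sigma> (h x)) \<in> superpositions \<sigma> H"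
  | add: "u \<in> superpositions \<sigma> H \<Longrightarrow> v \<in> superpositions \<sigma> H \<Longrightarrow>
      (\<lambda>x. u x + v x) \<in> superpositions \<sigma> H"

lemma superpositions_sum:
  assumes "v \<in> superpositions \<sigma> H"
  obtains m :: nat and w h where "m \<ge> 1" "\<forall>l\<in>{1..m}. h l \<in> H"
    "\<And>x. v x = (\<Sum>l=1..m. w l * \<sigma> (h l x))"
proof -
  have "\<exists>(m::nat) w h. m \<ge> 1 \<and> (\<forall>l\<in>{1..m}. h l \<in> H) \<and>
      (\<forall>x. v x = (\<Sum>l=1..m. w l * \<sigma> (h l x)))"
    using assms
  proof induction
    case (unit h w)
    then show ?case
      by (intro exI[of _ 1] exI[of _ "\<lambda>_. w"] exI[of _ "\<lambda>_. h"]) auto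
  next
    case (add u v)
    then obtain m w h m' w' h' where
      u: "m \<ge> (1::nat)" "\<forall>l\<in>{1..m}. h l \<in> H" "\<And>x. u x = (\<Sum>l=1..m. w l * \<sigma> (h l x))" and
      v: "m' \<ge> (1::nat)" "\<forall>l\<in>{1..m'}. h' l \<in> H" "\<And>x. v x = (\<Sum>l=1..m'. w' l * \<sigma> (h' l x))"
      by blast
    define w2 where "w2 l = (if l \<le> m then w l else w' (l - m))" for l
    define h2 where "h2 l = (if l \<le> m then h l else h' (l - m))" for l
    have "u x + v x = (\<Sum>l=1..m+m'. w2 l * \<sigma> (h2 l x))" for x
    proof -
      have "(\<Sum>l=1..m+m'. w2 l * \<sigma> (h2 l x)) =
          (\<Sum>l=1..m. w2 l * \<sigma> (h2 l x)) + (\<Sum>l=m+1..m+m'. w2 l * \<sigma> (h2 l x))"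
        by (rule sum.ub_add_nat) simp
      also have "(\<Sum>l=m+1..m+m'. w2 l * \<sigma> (h2 l x)) = (\<Sum>l=1..m'. w' l * \<sigma> (h' l x))"
        by (rule sum.reindex_bij_witness[of _ "\<lambda>l. l + m" "\<lambda>l. l - m"])
          (auto simp: w2_def h2_def)
      finally show ?thesis
        by (simp add: u(3) v(3) w2_def h2_def)
    qed
    moreover have "\<forall>l\<in>{1..m+m'}. h2 l \<in> H"
      by (auto simp: h2_def intro!: bspec[OF u(2)] bspec[OF v(2)])
    moreover have "m + m' \<ge> 1"
      using u(1) by simp
    ultimately show ?case
      by blast
  qed
  with that show thesis by blast
qed

text \<open>Transfers superpositions from continuous inner functions to a dense class
  \<open>H\<close>: \<open>\<sigma>\<close> is uniformly continuous on bounded intervals, so a small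
  uniform change of the inner function changes each term only slightly, and the weights stay as they
  are.\<close>

lemma superpositions_approx:
  fixes \<sigma> :: "real \<Rightarrow> real" and X :: "'a::topological_space set"
  assumes \<sigma>: "continuous_on UNIV \<sigma>" and X: "compact X"
    and dense: "\<And>g e. continuous_on X g \<Longrightarrow> e > 0 \<Longrightarrow> \<exists>h\<in>H. \<forall>x\<in>X. \<bar>h x - g x\<bar> < e"
    and v: "v \<in> superpositions \<sigma> {g. continuous_on X g}" and e: "e > 0"
  shows "\<exists>u\<in>superpositions \<sigma> H. \<forall>x\<in>X. \<bar>u x - v x\<bar> < e"
  using v e
proof (induction arbitrary: e)
  case (unit g w)
  then have g: "continuous_on X g" by simp
  obtain R where R: "\<forall>x\<in>X. \<bar>g x\<bar> \<le> R"
    using compact_imp_bounded[OF compact_continuous_image[OF g X]]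
    unfolding bounded_real by auto
  \<comment> \<open>The margin 1 around the range of \<open>g\<close> leaves room for the values of
    \<open>h\<close>; this is why \<open>h\<close> is chosen within \<open>min d 1\<close> of
    \<open>g\<close>. The tolerance is divided by \<open>\<bar>w\<bar> + 1\<close> so that
    \<open>w = 0\<close> is covered too.\<close>
  have "uniformly_continuous_on {-(R+1)..R+1} \<sigma>"
    by (intro compact_uniformly_continuous continuous_on_subset[OF \<sigma>]) auto
  moreover have "e / (\<bar>w\<bar> + 1) > 0" using unit by simp
  ultimately obtain d where d: "d > 0"
    "\<And>s t. s \<in> {-(R+1)..R+1} \<Longrightarrow> t \<in> {-(R+1)..R+1} \<Longrightarrow> dist t s < d \<Longrightarrow>
       dist (\<sigma> t) (\<sigma> s) < e / (\<bar>w\<bar> + 1)"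
    unfolding uniformly_continuous_on_def by metis
  obtain h where h: "h \<in> H" "\<And>x. x \<in> X \<Longrightarrow> \<bar>h x - g x\<bar> < min d 1"
    using dense[OF g, of "min d 1"] d(1) by auto
  have "\<bar>w * \<sigma> (h x) - w * \<sigma> (g x)\<bar> < e" if x: "x \<in> X" for x
  proof -
    have "\<bar>\<sigma> (h x) - \<sigma> (g x)\<bar> < e / (\<bar>w\<bar> + 1)"
      using d(2)[of "g x" "h x"] h(2)[OF x] R x by (force simp: dist_real_def)
    then have "(\<bar>w\<bar> + 1) * \<bar>\<sigma> (h x) - \<sigma> (g x)\<bar> < e"
      by (simp add: field_simps)
    moreover have "\<bar>w\<bar> * \<bar>\<sigma> (h x) - \<sigma> (g x)\<bar> \<le> (\<bar>w\<bar> + 1) * \<bar>\<sigma> (h x) - \<sigma> (g x)\<bar>"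
      by (intro mult_right_mono) auto
    ultimately show ?thesis
      by (simp add: abs_mult flip: right_diff_distrib)
  qed
  then show ?case
    by (intro bexI[OF _ superpositions.unit[OF h(1), of w]]) blast
next
  case (add u v)
  obtain u' where "u' \<in> superpositions \<sigma> H" "\<forall>x\<in>X. \<bar>u' x - u x\<bar> < e/2"
    using add.IH(1)[of "e/2"] add.prems by auto
  moreover obtain v' where "v' \<in> superpositions \<sigma> H" "\<forall>x\<in>X. \<bar>v' x - v x\<bar> < e/2"
    using add.IH(2)[of "e/2"] add.prems by auto
  ultimately have uv: "(\<lambda>x. u' x + v' x) \<in> superpositions \<sigma> H"
    and "\<forall>x\<in>X. \<bar>u' x - u x\<bar> < e/2 \<and> \<bar>v' x - v x\<bar> < e/2"
    by (auto intro: superpositions.add)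
  then have "\<forall>x\<in>X. \<bar>u' x + v' x - (u x + v x)\<bar> < e"
    by (smt (verit) field_sum_of_halves)
  with uv show ?case by (intro bexI[of _ "\<lambda>x. u' x + v' x"])
qed

text \<open>One Tietze step. The approximant takes values between \<open>-M/3\<close> and
  \<open>M/3\<close> and equals the nearer of these two bounds wherever
  \<open>\<bar>f x\<bar> \<ge> M/3\<close>, so the error is at most two thirds of \<open>M\<close>.
  Between the two bounds the shape of \<open>\<sigma>\<close> is irrelevant, hence no monotonicity
  enters.\<close>

lemma superpositions_contraction_step:
  fixes \<sigma> :: "real \<Rightarrow> real" and X :: "'a::topological_space set"
  assumes \<sigma>: "continuous_on UNIV \<sigma>" and ne: "\<sigma> p \<noteq> \<sigma> q"
    and f: "continuous_on X f" and M: "M > 0" "\<forall>x\<in>X. \<bar>f x\<bar> \<le> M"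
  shows "\<exists>v\<in>superpositions \<sigma> {g. continuous_on X g}. \<forall>x\<in>X. \<bar>f x - v x\<bar> \<le> 2/3 * M"
proof -
  let ?N = "superpositions \<sigma> {g. continuous_on X g}"
  let ?I = "{min p q..max p q}"
  have cont: "continuous_on ?I \<sigma>"
    by (rule continuous_on_subset[OF \<sigma>]) simp
  obtain a where a: "a \<in> ?I" "\<forall>t\<in>?I. \<sigma> a \<le> \<sigma> t"
    using continuous_attains_inf[OF compact_Icc _ cont] by fastforce
  obtain b where b: "b \<in> ?I" "\<forall>t\<in>?I. \<sigma> t \<le> \<sigma> b"
    using continuous_attains_sup[OF compact_Icc _ cont] by fastforce
  have "p \<in> ?I" "q \<in> ?I" by auto
  then have "\<sigma> a \<le> \<sigma> p" "\<sigma> a \<le> \<sigma> q" "\<sigma> p \<le> \<sigma> b" "\<sigma> q \<le> \<sigma> b"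
    using a b by auto
  with ne have ab: "\<sigma> a < \<sigma> b"
    by linarith
  \<comment> \<open>Superpositions have no bias term; an additive constant is a weight times
    \<open>\<sigma>\<close> of the constant inner function \<open>r\<close>.\<close>
  then obtain r where r: "\<sigma> r \<noteq> 0"
    by (metis less_irrefl)
  \<comment> \<open>A clamped affine ramp: 0 for \<open>f x \<le> -M/3\<close> and 1 for
    \<open>f x \<ge> M/3\<close>. Accordingly \<open>h\<close> moves from the minimizer
    \<open>a\<close> to the maximizer \<open>b\<close>, and \<open>K\<close> scales the range from
    \<open>\<sigma> a\<close> to \<open>\<sigma> b\<close> to length \<open>2/3 * M\<close>.\<close>
  define \<tau> where "\<tau> x = max 0 (min 1 (f x * 3 / (2 * M) + 1/2))" for x
  define h where "h x = (1 - \<tau> x) * a + \<tau> x * b" for x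
  define K where "K = 2/3 * M / (\<sigma> b - \<sigma> a)"
  have h: "continuous_on X h"
    unfolding h_def \<tau>_def by (intro continuous_intros f) (use M in auto)
  have "(\<lambda>x. K * \<sigma> (h x) + (- K * \<sigma> a - M/3) / \<sigma> r * \<sigma> r) \<in> ?N"
    by (intro superpositions.add superpositions.unit[of h]
        superpositions.unit[of "\<lambda>_. r"]) (use h in auto)
  moreover have "\<bar>f x - (K * \<sigma> (h x) + (- K * \<sigma> a - M/3) / \<sigma> r * \<sigma> r)\<bar> \<le> 2/3 * M"
    if x: "x \<in> X" for x
  proof -
    define v where "v = (\<sigma> (h x) - \<sigma> a) / (\<sigma> b - \<sigma> a)"
    have "K * (\<sigma> (h x) - \<sigma> a) = 2/3 * (M * v)"
      by (simp add: K_def v_def)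
    then have eq: "K * \<sigma> (h x) + (- K * \<sigma> a - M/3) / \<sigma> r * \<sigma> r = 2/3 * (M * v) - M/3"
      using r by (simp add: right_diff_distrib)
    have \<tau>: "0 \<le> \<tau> x" "\<tau> x \<le> 1" by (auto simp: \<tau>_def)
    \<comment> \<open>By convexity \<open>h\<close> never leaves the interval on which
      \<open>a\<close> and \<open>b\<close> are extremal, so the normalized value \<open>v\<close>
      lies in the unit interval.\<close>
    have "h x \<in> ?I"
      unfolding h_def using convexD[of ?I a b "1 - \<tau> x" "\<tau> x"] a b \<tau> by simp
    then have v01: "0 \<le> v" "v \<le> 1"
      using a b ab by (auto simp: v_def)
    then have Mv: "0 \<le> M * v" "M * v \<le> M"
      using M by (auto simp: mult_left_le)
    have fx: "\<bar>f x\<bar> \<le> M" using M x by blast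
    consider "f x \<le> - M/3" | "f x \<ge> M/3" | "- M/3 < f x" "f x < M/3" by linarith
    then show ?thesis
    proof cases
      case 1
      then have "\<tau> x = 0" using M by (simp add: \<tau>_def field_simps)
      then have "v = 0" by (simp add: v_def h_def)
      then show ?thesis unfolding eq using fx 1 by simp
    next
      case 2
      then have "f x * 3 / (2 * M) + 1/2 \<ge> 1" using M by (simp add: field_simps)
      then have "\<tau> x = 1" by (simp add: \<tau>_def)
      then have "v = 1" using ab by (simp add: v_def h_def)
      then show ?thesis unfolding eq using fx 2 by simp
    next
      case 3
      then show ?thesis unfolding eq abs_le_iff using Mv by linarith
    qed
  qed
  ultimately show ?thesis
    by (intro bexI[of _ "\<lambda>x. K * \<sigma> (h x) + (- K * \<sigma> a - M/3) / \<sigma> r * \<sigma> r"]) auto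
qed

lemma continuous_on_superposition:
  assumes "continuous_on UNIV \<sigma>" "v \<in> superpositions \<sigma> {g. continuous_on X g}"
  shows "continuous_on X v"
  using assms(2)
proof induction
  case (unit h w)
  then have "continuous_on X (\<lambda>x. \<sigma> (h x))"
    using continuous_on_compose2[OF assms(1)] by blast
  then show ?case by (rule continuous_on_mult_left)
qed (rule continuous_on_add)

text \<open>Each contraction step is applied to the residual of the previous ones, which is again
  continuous, so the error bound decays geometrically.\<close>

proposition superpositions_dense:
  fixes \<sigma> :: "real \<Rightarrow> real" and X :: "'a::topological_space set"
  assumes \<sigma>: "continuous_on UNIV \<sigma>" and ne: "\<sigma> p \<noteq> \<sigma> q" and X: "compact X"
    and f: "continuous_on X f" and e: "e > 0"
  shows "\<exists>v\<in>superpositions \<sigma> {g. continuous_on X g}. \<forall>x\<in>X. \<bar>f x - v x\<bar> < e"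
proof -
  let ?N = "superpositions \<sigma> {g. continuous_on X g}"
  obtain M0 where M0: "\<forall>x\<in>X. \<bar>f x\<bar> \<le> M0"
    using compact_imp_bounded[OF compact_continuous_image[OF f X]]
    unfolding bounded_real by auto
  \<comment> \<open>Strictly positive even for \<open>f = 0\<close> or empty \<open>X\<close>, as
    the contraction step demands.\<close>
  define M where "M = \<bar>M0\<bar> + 1"
  have M: "M > 0" "\<forall>x\<in>X. \<bar>f x\<bar> \<le> M"
    using M0 by (force simp: M_def)+
  have step: "\<exists>v\<in>?N. \<forall>x\<in>X. \<bar>f x - v x\<bar> \<le> (2/3) ^ Suc k * M" for k
  proof (induction k)
    case 0
    show ?case
      using superpositions_contraction_step[OF \<sigma> ne f M] by simp
  next
    case (Suc k)
    then obtain u where u: "u \<in> ?N" "\<forall>x\<in>X. \<bar>f x - u x\<bar> \<le> (2/3) ^ Suc k * M" by blast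
    have "continuous_on X (\<lambda>x. f x - u x)"
      by (intro continuous_intros f continuous_on_superposition[OF \<sigma> u(1)])
    from superpositions_contraction_step[OF \<sigma> ne this _ u(2)] M obtain v
      where v: "v \<in> ?N" "\<forall>x\<in>X. \<bar>f x - u x - v x\<bar> \<le> 2/3 * ((2/3) ^ Suc k * M)"
      by auto
    show ?case
      by (rule bexI[OF _ superpositions.add[OF u(1) v(1)]]) (use v in \<open>simp add: algebra_simps\<close>)
  qed
  have "(\<lambda>k. (2/3) ^ Suc k * M) \<longlonglongrightarrow> 0"
    by (intro tendsto_mult_left_zero LIMSEQ_Suc LIMSEQ_power_zero) simp
  then have "\<forall>\<^sub>F k in sequentially. (2/3) ^ Suc k * M < e"
    using e by (rule order_tendstoD)
  then obtain k where "(2/3) ^ Suc k * M < e"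
    by (auto simp: eventually_sequentially)
  then show ?thesis
    using step[of k] by (meson le_less_trans)
qed

section \<open>Sums of products of univariate functions\<close>

text \<open>The algebraic tensor product of the spaces of continuous functions on the unit interval;
  scalars can be absorbed into a factor of each product.\<close>

inductive_set separable :: "nat \<Rightarrow> ((nat \<Rightarrow> real) \<Rightarrow> real) set" for n :: nat
  where
    product: "\<forall>j\<in>{1..n}. continuous_on {0..1} (q j) \<Longrightarrow> (\<lambda>x. \<Prod>j=1..n. q j (x j)) \<in> separable n"
  | add: "u \<in> separable n \<Longrightarrow> v \<in> separable n \<Longrightarrow> (\<lambda>x. u x + v x) \<in> separable n"

text \<open>Two products merge factor by factor at each site; distributivity does the rest, by
  induction on \<open>u\<close> and, for \<open>u\<close> a single product, on
  \<open>v\<close>.\<close>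

lemma separable_mult:
  assumes "u \<in> separable n" "v \<in> separable n"
  shows "(\<lambda>x. u x * v x) \<in> separable n"
  using assms(1)
proof induction
  case (product q)
  show ?case
    using assms(2)
  proof induction
    case (product r)
    have "(\<lambda>x. \<Prod>j=1..n. (\<lambda>t. q j t * r j t) (x j)) \<in> separable n"
      using \<open>\<forall>j\<in>{1..n}. continuous_on {0..1} (q j)\<close> product
      by (intro separable.product) (auto intro!: continuous_intros)
    then show ?case by (simp add: prod.distrib)
  next
    case (add u v)
    from separable.add[OF add.IH] show ?case by (simp add: distrib_left)
  qed
next
  case (add u v)
  from separable.add[OF add.IH] show ?case by (simp add: distrib_right)
qed

lemma separable_const:
  assumes "n \<ge> 1"
  shows "(\<lambda>_. c) \<in> separable n"
proof -
  \<comment> \<open>The constant is carried by the factor at site 1, which exists since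
    \<open>n \<ge> 1\<close>.\<close>
  have "(\<lambda>x. \<Prod>j=1..n. (\<lambda>t. if j = 1 then c else 1) (x j)) \<in> separable n"
    by (intro separable.product) auto
  then show ?thesis using assms by (simp add: prod.delta)
qed

lemma separable_coordinate:
  assumes "j \<in> {1..n}"
  shows "(\<lambda>x. x j) \<in> separable n"
proof -
  have "(\<lambda>x. \<Prod>i=1..n. (if i = j then (\<lambda>t. t) else (\<lambda>_. 1)) (x i)) \<in> separable n"
    by (intro separable.product ballI) (simp split: if_split)
  then show ?thesis using assms by (simp add: if_distribR prod.delta)
qed

lemma continuous_on_hypercube_coordinate:
  assumes "j \<in> {1..n}" "continuous_on {0..1} (g :: real \<Rightarrow> real)"
  shows "continuous_on (hypercube n) (\<lambda>x. g (x j))"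
proof (rule continuous_on_compose2[OF assms(2)])
  show "continuous_on (hypercube n) (\<lambda>x. x j)"
    by (rule continuous_on_subset[OF continuous_on_product_coordinates]) simp
  show "(\<lambda>x. x j) ` hypercube n \<subseteq> {0..1}"
    using assms(1) unfolding hypercube_def by (auto simp: PiE_iff)
qed

lemma continuous_on_separable:
  assumes "u \<in> separable n"
  shows "continuous_on (hypercube n) u"
  using assms
proof induction
  case (product q)
  then show ?case
    by (intro continuous_on_prod continuous_on_hypercube_coordinate) auto
qed (rule continuous_on_add)

lemma compact_hypercube: "compact (hypercube n)"
proof -
  \<comment> \<open>Extensional functions are \<open>undefined\<close> off \<open>{1..n}\<close>, so
    the hypercube is a full product with singleton factors there, and Tychonoff's theorem
    applies.\<close>
  have "hypercube n = PiE UNIV (\<lambda>i. if i \<in> {1..n} then {0..1} else {undefined})"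
    unfolding hypercube_def PiE_def Pi_def extensional_def by (intro set_eqI) (simp, meson)
  moreover have "compactin (product_topology (\<lambda>_. euclidean) UNIV)
      (PiE UNIV (\<lambda>i. if i \<in> {1..n} then {0..1::real} else {undefined}))"
    by (auto simp: compactin_PiE)
  ultimately show ?thesis
    by (metis compactin_euclidean_iff euclidean_product_topology)
qed

lemma separable_dense:
  assumes n: "n \<ge> 1" and f: "continuous_on (hypercube n) f" and e: "e > 0"
  shows "\<exists>g\<in>separable n. \<forall>x\<in>hypercube n. \<bar>g x - f x\<bar> < e"
proof -
  interpret function_ring_on "separable n" "hypercube n"
  proof
    show "\<exists>g\<in>separable n. g x \<noteq> g y"
      if xy: "x \<in> hypercube n" "y \<in> hypercube n" "x \<noteq> y" for x y
    proof -
      obtain j where "j \<in> {1..n}" "x j \<noteq> y j"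
        using PiE_ext[OF xy(1,2)[unfolded hypercube_def]] xy(3) by blast
      then show ?thesis using separable_coordinate by (intro bexI[of _ "\<lambda>x. x j"])
    qed
  qed (rule compact_hypercube continuous_on_separable separable.add separable_mult
      separable_const[OF n]; assumption)+
  show ?thesis
    using Stone_Weierstrass_basic[OF f e] by (auto simp: abs_minus_commute)
qed

text \<open>Indexing by the families \<open>q\<close> themselves, with coefficients that vanish
  outside \<open>F\<close>, lets two representations be added over the union of their index sets;
  common families simply add their coefficients.\<close>

lemma separable_finite_representation:
  assumes "u \<in> separable n"
  shows "\<exists>F c. finite F \<and> (\<forall>q\<in>F. \<forall>j\<in>{1..n}. continuous_on {0..1} (q j)) \<and>
    (\<forall>q. q \<notin> F \<longrightarrow> c q = 0) \<and> (\<forall>x. u x = (\<Sum>q\<in>F. c q * (\<Prod>j=1..n. q j (x j))))"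
  using assms
proof induction
  case (product q)
  then show ?case
    by (intro exI[of _ "{q}"] exI[of _ "\<lambda>r. of_bool (r = q)"] conjI) simp_all
next
  case (add u v)
  from add.IH(1) obtain F c where
    u: "finite F" "\<forall>q\<in>F. \<forall>j\<in>{1..n}. continuous_on {0..1} (q j)" "\<forall>q. q \<notin> F \<longrightarrow> c q = 0"
    "\<And>x. u x = (\<Sum>q\<in>F. c q * (\<Prod>j=1..n. q j (x j)))"
    by blast
  from add.IH(2) obtain G b where
    v: "finite G" "\<forall>q\<in>G. \<forall>j\<in>{1..n}. continuous_on {0..1} (q j)" "\<forall>q. q \<notin> G \<longrightarrow> b q = 0"
    "\<And>x. v x = (\<Sum>q\<in>G. b q * (\<Prod>j=1..n. q j (x j)))"
    by blast
  have "u x + v x = (\<Sum>q\<in>F\<union>G. (c q + b q) * (\<Prod>j=1..n. q j (x j)))" for x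
  proof -
    have "u x = (\<Sum>q\<in>F\<union>G. c q * (\<Prod>j=1..n. q j (x j)))"
      unfolding u(4) by (rule sum.mono_neutral_left) (use u v in auto)
    moreover have "v x = (\<Sum>q\<in>F\<union>G. b q * (\<Prod>j=1..n. q j (x j)))"
      unfolding v(4) by (rule sum.mono_neutral_left) (use u v in auto)
    ultimately show ?thesis by (simp add: distrib_right sum.distrib)
  qed
  then show ?case
    using u(1-3) v(1-3)
    by (intro exI[of _ "F \<union> G"] exI[of _ "\<lambda>q. c q + b q"]) auto
qed

text \<open>In an activated MPS function all terms share the kernel maps, and \<open>l\<close>
  enters only through the tensor \<open>B\<close>. Hence the families of all \<open>g l\<close> are
  pooled and numbered by \<open>p\<close>, leaving only the coefficients dependent on
  \<open>l\<close>.\<close>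

lemma separable_common_representation:
  fixes g :: "nat \<Rightarrow> (nat \<Rightarrow> real) \<Rightarrow> real"
  assumes "\<forall>l\<in>{1..m}. g l \<in> separable n"
  obtains P :: nat and q c where "P \<ge> 1"
    "\<forall>p\<in>{1..P}. \<forall>j\<in>{1..n}. continuous_on {0..1} (q p j)"
    "\<forall>l\<in>{1..m}. \<forall>x. g l x = (\<Sum>p=1..P. c l p * (\<Prod>j=1..n. q p j (x j)))"
proof -
  have "\<forall>l\<in>{1..m}. \<exists>F c. finite F \<and> (\<forall>q\<in>F. \<forall>j\<in>{1..n}. continuous_on {0..1} (q j)) \<and>
    (\<forall>q. q \<notin> F \<longrightarrow> c q = 0) \<and> (\<forall>x. g l x = (\<Sum>q\<in>F. c q * (\<Prod>j=1..n. q j (x j))))"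
    using assms separable_finite_representation by blast
  from bchoice[OF this] obtain F where
    "\<forall>l\<in>{1..m}. \<exists>c. finite (F l) \<and>
      (\<forall>q\<in>F l. \<forall>j\<in>{1..n}. continuous_on {0..1} (q j)) \<and> (\<forall>q. q \<notin> F l \<longrightarrow> c q = 0) \<and>
      (\<forall>x. g l x = (\<Sum>q\<in>F l. c q * (\<Prod>j=1..n. q j (x j))))"
    by blast
  from bchoice[OF this] obtain c where
    F: "\<And>l. l \<in> {1..m} \<Longrightarrow> finite (F l)"
      "\<And>l q j. l \<in> {1..m} \<Longrightarrow> q \<in> F l \<Longrightarrow> j \<in> {1..n} \<Longrightarrow> continuous_on {0..1} (q j)"
      "\<And>l q. l \<in> {1..m} \<Longrightarrow> q \<notin> F l \<Longrightarrow> c l q = 0"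
      "\<And>l x. l \<in> {1..m} \<Longrightarrow> g l x = (\<Sum>q\<in>F l. c l q * (\<Prod>j=1..n. q j (x j)))"
    by blast
  \<comment> \<open>The zero family is inserted so that there is at least one term also for \<open>m = 0\<close>.\<close>
  define G where "G = insert (\<lambda>_ _. 0) (\<Union>l\<in>{1..m}. F l)"
  have finG: "finite G"
    using F(1) by (auto simp: G_def)
  then have card: "card G \<ge> 1"
    by (auto simp: G_def Suc_le_eq card_gt_0_iff)
  obtain q where q: "bij_betw q {1..card G} G"
    using ex_bij_betw_nat_finite_1[OF finG] by blast
  have "g l x = (\<Sum>p=1..card G. c l (q p) * (\<Prod>j=1..n. q p j (x j)))" if l: "l \<in> {1..m}" for l x
  proof -
    have "g l x = (\<Sum>r\<in>G. c l r * (\<Prod>j=1..n. r j (x j)))"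
      unfolding F(4)[OF l]
      by (rule sum.mono_neutral_left) (use finG l F(3)[OF l] in \<open>auto simp: G_def\<close>)
    then show ?thesis
      using sum.reindex_bij_betw[OF q, of "\<lambda>r. c l r * (\<Prod>j=1..n. r j (x j))"] by simp
  qed
  moreover have "continuous_on {0..1} (q p j)" if "p \<in> {1..card G}" "j \<in> {1..n}" for p j
  proof -
    have "q p \<in> G" using q that by (auto simp: bij_betw_def)
    then show ?thesis using F(2) that by (auto simp: G_def)
  qed
  ultimately show thesis
    using card by (intro that[of "card G" q "\<lambda>l p. c l (q p)"]) auto
qed

section \<open>Diagonal site tensors\<close>

lemma cyc_next_mem: "j \<in> {1..n} \<Longrightarrow> cyc_next n j \<in> {1..n}"
  by (auto simp: cyc_next_def)

text \<open>Each site tensor forces its physical index and both bond indices to agree. Around the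
  ring all indices then equal a single \<open>p\<close>, so the contraction collapses to one sum, in
  which site 1 supplies the coefficient \<open>c p\<close> and every other site the factor
  1.\<close>

lemma mps_contraction_diagonal:
  assumes n: "n \<ge> 1"
    and T: "\<And>j s a b. T j s a b = (if a = s \<and> b = s then if j = 1 then c s else 1 else 0)"
  shows "mps_contraction n (\<lambda>_. P) (\<lambda>_. P) T (\<lambda>j t s. q s j t) x =
    (\<Sum>p=1..P. c p * (\<Prod>j=1..n. q p j (x j)))"
proof -
  define E where "E = (\<Pi>\<^sub>E j\<in>{1..n}. {1..P})"
  \<comment> \<open>The constant index assignment, restricted to the sites so that it belongs to the
    extensional set \<open>E\<close>.\<close>
  define k where "k p = (\<lambda>j\<in>{1..n}. p :: nat)" for p
  define t where "t \<alpha> s = (\<Prod>j=1..n. T j (s j) (\<alpha> j) (\<alpha> (cyc_next n j))) *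
    product_kernel n (\<lambda>j t s. q s j t) s x" for \<alpha> s :: "nat \<Rightarrow> nat"
  have finE: "finite E" unfolding E_def by (intro finite_PiE) auto
  have one: "1 \<in> {1..n}" using n by simp
  have inj: "inj_on (\<lambda>p. (k p, k p)) {1..P}"
    by (rule inj_onI) (use one in \<open>auto simp: k_def dest: fun_cong[of _ _ 1]\<close>)
  have zero: "t \<alpha> s = 0" if "\<alpha> \<in> E" "s \<in> E" "(\<alpha>, s) \<notin> (\<lambda>p. (k p, k p)) ` {1..P}" for \<alpha> s
  proof (rule ccontr)
    assume "t \<alpha> s \<noteq> 0"
    then have "T j (s j) (\<alpha> j) (\<alpha> (cyc_next n j)) \<noteq> 0" if "j \<in> {1..n}" for j
      using that by (auto simp: t_def)
    then have eq: "\<alpha> j = s j" "\<alpha> (cyc_next n j) = s j" if "j \<in> {1..n}" for j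
      using that unfolding T by metis+
    \<comment> \<open>Site \<open>j\<close> links its two bonds,
      \<open>\<alpha> j = s j = \<alpha> (j + 1)\<close> for \<open>j < n\<close>, so equality
      propagates from site 1 along the chain.\<close>
    have const: "1 \<le> j \<Longrightarrow> j \<le> n \<Longrightarrow> \<alpha> j = \<alpha> 1" for j
    proof (induction j rule: dec_induct)
      case (step j)
      then show ?case using eq[of j] by (auto simp: cyc_next_def)
    qed simp
    have ext: "\<alpha> \<in> extensional {1..n}" "s \<in> extensional {1..n}"
      using that(1,2) by (auto simp: E_def PiE_iff)
    have "\<alpha> j = k (\<alpha> 1) j" "s j = k (\<alpha> 1) j" if "j \<in> {1..n}" for j
      using const[of j] eq(1)[OF that] that by (auto simp: k_def)
    moreover have "k (\<alpha> 1) \<in> extensional {1..n}"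
      by (simp add: k_def)
    ultimately have "\<alpha> = k (\<alpha> 1)" "s = k (\<alpha> 1)"
      using ext by (blast intro: extensionalityI)+
    moreover have "\<alpha> 1 \<in> {1..P}"
      using that(1) one unfolding E_def by (meson PiE_mem)
    ultimately show False using that(3) by blast
  qed
  have kE: "k p \<in> E" if "p \<in> {1..P}" for p
    using that by (simp add: E_def k_def)
  have diag: "t (k p) (k p) = c p * (\<Prod>j=1..n. q p j (x j))" for p
  proof -
    have "(\<Prod>j=1..n. T j (k p j) (k p j) (k p (cyc_next n j))) = (\<Prod>j=1..n. if j = 1 then c p else 1)"
      using cyc_next_mem[of _ n] by (intro prod.cong) (auto simp: T k_def)
    also have "\<dots> = c p" using one by (simp add: prod.delta)
    finally show ?thesis
      by (simp add: t_def product_kernel_def k_def)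
  qed
  have "mps_contraction n (\<lambda>_. P) (\<lambda>_. P) T (\<lambda>j t s. q s j t) x = (\<Sum>\<alpha>\<in>E. \<Sum>s\<in>E. t \<alpha> s)"
    by (simp add: mps_contraction_def E_def t_def)
  also have "\<dots> = (\<Sum>(\<alpha>, s)\<in>E \<times> E. t \<alpha> s)"
    by (rule sum.cartesian_product)
  also have "\<dots> = (\<Sum>(\<alpha>, s)\<in>(\<lambda>p. (k p, k p)) ` {1..P}. t \<alpha> s)"
    by (rule sum.mono_neutral_right) (use finE kE zero in auto)
  also have "\<dots> = (\<Sum>p=1..P. t (k p) (k p))"
    unfolding sum.reindex[OF inj] by simp
  finally show ?thesis by (simp add: diag)
qed

text \<open>The weight \<open>w l\<close> is absorbed into the activation, which scaling keeps in
  \<open>S\<close>. Site 1 carries the extra index: \<open>B l\<close> holds the coefficients of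
  \<open>g l\<close> on its diagonal, and all physical and bond dimensions equal the number
  \<open>P\<close> of pooled products.\<close>

lemma superposition_in_activated_mps:
  assumes n: "n \<ge> 1" and S: "\<And>w. (\<lambda>x. w * \<sigma> x) \<in> S"
    and u: "u \<in> superpositions \<sigma> (separable n)"
  shows "u \<in> activated_mps n S"
proof -
  obtain m w g where m: "m \<ge> (1::nat)" and g: "\<forall>l\<in>{1..m}. g l \<in> separable n"
    and ueq: "\<And>x. u x = (\<Sum>l=1..m. w l * \<sigma> (g l x))"
    by (rule superpositions_sum[OF u], rule that)
  obtain P :: nat and q c where P: "P \<ge> 1"
    and q: "\<forall>p\<in>{1..P}. \<forall>j\<in>{1..n}. continuous_on {0..1} (q p j)"
    and geq: "\<forall>l\<in>{1..m}. \<forall>x. g l x = (\<Sum>p=1..P. c l p * (\<Prod>j=1..n. q p j (x j)))"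
    by (rule separable_common_representation[OF g])
  define A :: "nat \<Rightarrow> nat \<Rightarrow> nat \<Rightarrow> nat \<Rightarrow> real"
    where "A j s a b = (if a = s \<and> b = s then 1 else 0)" for j s a b
  define B where "B l s a b = (if a = s \<and> b = s then c l s else 0)" for l s a b :: nat
  have "mps_contraction n (\<lambda>_. P) (\<lambda>_. P) (A(1 := B l)) (\<lambda>j t s. q s j t) x = g l x"
    if "l \<in> {1..m}" for l x
    using geq that mps_contraction_diagonal[OF n, of "A(1 := B l)" "c l"]
    by (simp add: A_def B_def)
  then have "\<forall>x\<in>hypercube n. u x = (\<Sum>l=1..m. (\<lambda>x. w l * \<sigma> x)
      (mps_contraction n (\<lambda>_. P) (\<lambda>_. P) (A(1 := B l)) (\<lambda>j t s. q s j t) x))"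
    by (simp add: ueq)
  moreover have "\<forall>j\<in>{1..n}. \<forall>s\<in>{1..P}. continuous_on {0..1} (\<lambda>t. q s j t)"
    using q by simp
  moreover have "1 \<in> {1..n}" "\<forall>l\<in>{1..m}. (\<lambda>x. w l * \<sigma> x) \<in> S"
    "\<forall>j\<in>{1..n}. P \<ge> 1 \<and> P \<ge> 1"
    using n S P by auto
  ultimately show ?thesis
    unfolding activated_mps_def using m
    by (intro CollectI exI[of _ m] exI[of _ "\<lambda>l x. w l * \<sigma> x"] exI[of _ 1] exI[of _ "\<lambda>_. P"]
        exI[of _ A] exI[of _ B] exI[of _ "\<lambda>j t s. q s j t"] conjI)
qed

section \<open>Density of activated MPS functions\<close>

theorem theorem3p1:
  fixes n :: nat and S :: "(real \<Rightarrow> real) set"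
    and f :: "(nat \<Rightarrow> real) \<Rightarrow> real" and \<epsilon> :: real
  assumes "n \<ge> 1"
    and "scale_invariant_sigmoidal S"
    and "continuous_on (hypercube n) f"
    and "\<epsilon> > 0"
  shows "\<exists>\<Psi>\<in>activated_mps n S. (SUP x\<in>hypercube n. \<bar>\<Psi> x - f x\<bar>) < \<epsilon>"
proof -
  obtain \<sigma> C where \<sigma>: "\<sigma> \<in> S" "C \<noteq> 0" "(\<sigma> \<longlongrightarrow> C) at_top" "(\<sigma> \<longlongrightarrow> 0) at_bot"
    "continuous_on UNIV \<sigma>" "\<And>k. (\<lambda>x. k * \<sigma> x) \<in> S"
    using assms(2) unfolding scale_invariant_sigmoidal_def by metis
  \<comment> \<open>A constant \<open>\<sigma>\<close> would equal both of its limits, 0 and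
    \<open>C\<close>, contradicting \<open>C \<noteq> 0\<close>.\<close>
  have "\<exists>p q. \<sigma> p \<noteq> \<sigma> q"
  proof (rule ccontr)
    assume "\<not> ?thesis"
    then have "\<sigma> = (\<lambda>_. \<sigma> 0)" by auto
    then have "\<sigma> 0 = C" "\<sigma> 0 = 0"
      using \<sigma>(3,4) by (metis tendsto_const tendsto_unique trivial_limit_at_top_linorder,
        metis tendsto_const tendsto_unique trivial_limit_at_bot_linorder)
    with \<sigma>(2) show False by simp
  qed
  then obtain p q where "\<sigma> p \<noteq> \<sigma> q" by blast
  \<comment> \<open>Passing from \<open>f\<close> to \<open>v\<close> and from \<open>v\<close> to
    \<open>u\<close> costs a quarter of \<open>\<epsilon>\<close> each. Pointwise bounds give only a
    weak inequality for the supremum, and \<open>\<epsilon>/2\<close> keeps the final one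
    strict.\<close>
  from superpositions_dense[OF \<sigma>(5) this compact_hypercube assms(3), of "\<epsilon>/4"] assms(4)
  obtain v where v: "v \<in> superpositions \<sigma> {g. continuous_on (hypercube n) g}"
    "\<forall>x\<in>hypercube n. \<bar>f x - v x\<bar> < \<epsilon>/4"
    by auto
  obtain u where u: "u \<in> superpositions \<sigma> (separable n)"
    "\<forall>x\<in>hypercube n. \<bar>u x - v x\<bar> < \<epsilon>/4"
    using superpositions_approx[OF \<sigma>(5) compact_hypercube separable_dense[OF assms(1)] v(1),
        of "\<epsilon>/4"] assms(4) by auto
  have "(SUP x\<in>hypercube n. \<bar>u x - f x\<bar>) \<le> \<epsilon>/2"
  proof (rule cSUP_least)
    show "hypercube n \<noteq> {}" by (simp add: hypercube_def PiE_eq_empty_iff)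
    show "\<bar>u x - f x\<bar> \<le> \<epsilon>/2" if "x \<in> hypercube n" for x
      using u(2)[rule_format, OF that] v(2)[rule_format, OF that] by linarith
  qed
  also have "\<dots> < \<epsilon>" using assms(4) by simp
  finally show ?thesis
    using superposition_in_activated_mps[OF assms(1) \<sigma>(6) u(1)] by blast
qed

end
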